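(* Let $T=\begin{bmatrix} a & b\\ c & d\end{bmatrix}$ be a matrix in $U(1,1;\mathbb{H})$. If the corresponding quaternionic Möbius transformation $g_T(z)=(az+b)(cz+d)^{-1}$ is elliptic, then there exists a matrix $X\in U(1,1;\mathbb{H})$ such that $XTX^{-1}$ is a diagonal matrix.
   Context: $\mathbb{H}$ denotes the real quaternions. For $z=z_0+\mathbf{i}z_1+\mathbf{j}z_2+\mathbf{k}z_3\in\mathbb{H}$ ($z_i\in\mathbb{R}$), $z_0=Re(z)$ is the real part, $\overline{z}$ the quaternionic conjugate and $|z|=\sqrt{\overline{z}z}$; in particular $a_0,d_0$ denote the real parts of $a,d$. $U(1,1;\mathbb{H})$ is the group of all $A\in GL_2(\mathbb{H})$ (invertible $2\times 2$ quaternionic matrices) with $A^*JA=J$, where $A^*$ is the conjugate transpose and $J=\begin{bmatrix}1&0\\0&-1\end{bmatrix}$. Equivalently, $T=\begin{bmatrix} a & b\\ c & d\end{bmatrix}\in U(1,1;\mathbb{H})$ if and only if $|a|=|d|$, $|b|=|c|$, $|a|^2-|c|^2=1$, $\overline{a}b=\overline{c}d$ and $a\overline{c}=b\overline{d}$. For such $T$, $g_T(z)=(az+b)(cz+d)^{-1}$ is a quaternionic Möbius transformation of the unit ball $\{q\in\mathbb{H}:|q|<1\}$. Put $\triangle(T)=|b-\overline{c}|^2-(a_0-d_0)^2$. The transformation $g_T$ is called elliptic if one of the following holds: (1) $b=\overline{c}=0$; (2) $b=\overline{c}\neq 0$ and $d_0^2<1$; (3) $b\neq\overline{c}$, $\overline{c}\neq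 0$ and $\triangle(T)<0$. *)

theory Defs
  imports "HOL-Analysis.Analysis"
begin

section \<open>The real quaternions\<close>

datatype quat = Quat (re: real) (im1: real) (im2: real) (im3: real)

lemma quat_eq_iff:
  "x = y \<longleftrightarrow> re x = re y \<and> im1 x = im1 y \<and> im2 x = im2 y \<and> im3 x = im3 y"
  by (cases x; cases y) auto

instantiation quat :: ring_1
begin

definition "0 = Quat 0 0 0 0"
definition "1 = Quat 1 0 0 0"
definition "x + y = Quat (re x + re y) (im1 x + im1 y) (im2 x + im2 y) (im3 x + im3 y)"
definition "x - y = Quat (re x - re y) (im1 x - im1 y) (im2 x - im2 y) (im3 x - im3 y)"
definition "- x = Quat (- re x) (- im1 x) (- im2 x) (- im3 x)"
definition "x * y = Quat
  (re x * re y - im1 x * im1 y - im2 x * im2 y - im3 x * im3 y)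
  (re x * im1 y + im1 x * re y + im2 x * im3 y - im3 x * im2 y)
  (re x * im2 y - im1 x * im3 y + im2 x * re y + im3 x * im1 y)
  (re x * im3 y + im1 x * im2 y - im2 x * im1 y + im3 x * re y)"

instance
  by standard
    (simp_all add: quat_eq_iff zero_quat_def one_quat_def plus_quat_def minus_quat_def
      uminus_quat_def times_quat_def algebra_simps)

end

instantiation quat :: real_algebra_1
begin

definition "scaleR r x = Quat (r * re x) (r * im1 x) (r * im2 x) (r * im3 x)"

instance
  by standard
    (simp_all add: quat_eq_iff plus_quat_def times_quat_def scaleR_quat_def algebra_simps)

end

lemma quat_sel_simps [simp]:
  "re 0 = 0" "im1 0 = 0" "im2 0 = 0" "im3 0 = 0"
  "re 1 = 1" "im1 1 = 0" "im2 1 = 0" "im3 1 = 0"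
  "re (x + y) = re x + re y" "im1 (x + y) = im1 x + im1 y"
  "im2 (x + y) = im2 x + im2 y" "im3 (x + y) = im3 x + im3 y"
  "re (x - y) = re x - re y" "im1 (x - y) = im1 x - im1 y"
  "im2 (x - y) = im2 x - im2 y" "im3 (x - y) = im3 x - im3 y"
  "re (- x) = - re x" "im1 (- x) = - im1 x" "im2 (- x) = - im2 x" "im3 (- x) = - im3 x"
  "re (scaleR r x) = r * re x" "im1 (scaleR r x) = r * im1 x"
  "im2 (scaleR r x) = r * im2 x" "im3 (scaleR r x) = r * im3 x"
  "re (x * y) = re x * re y - im1 x * im1 y - im2 x * im2 y - im3 x * im3 y"
  "im1 (x * y) = re x * im1 y + im1 x * re y + im2 x * im3 y - im3 x * im2 y"
  "im2 (x * y) = re x * im2 y - im1 x * im3 y + im2 x * re y + im3 x * im1 y"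
  "im3 (x * y) = re x * im3 y + im1 x * im2 y - im2 x * im1 y + im3 x * re y"
  by (simp_all add: zero_quat_def one_quat_def plus_quat_def minus_quat_def
      uminus_quat_def scaleR_quat_def times_quat_def)

lemma quat_sel_of_real [simp]:
  "re (of_real r) = r" "im1 (of_real r) = 0" "im2 (of_real r) = 0" "im3 (of_real r) = 0"
  by (simp_all add: of_real_def)

definition qcnj :: "quat \<Rightarrow> quat" where
  "qcnj x = Quat (re x) (- im1 x) (- im2 x) (- im3 x)"

lemma qcnj_sel [simp]:
  "re (qcnj x) = re x" "im1 (qcnj x) = - im1 x" "im2 (qcnj x) = - im2 x" "im3 (qcnj x) = - im3 x"
  by (simp_all add: qcnj_def)

instantiation quat :: real_inner
begin

definition "inner x y = re x * re y + im1 x * im1 y + im2 x * im2 y + im3 x * im3 y"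
definition "norm x = sqrt ((re x)\<^sup>2 + (im1 x)\<^sup>2 + (im2 x)\<^sup>2 + (im3 x)\<^sup>2)"
definition "sgn x = x /\<^sub>R norm x" for x :: quat
definition "dist x y = norm (x - y)" for x y :: quat
definition [code del]:
  "(uniformity :: (quat \<times> quat) filter) = (INF e\<in>{0<..}. principal {(x, y). dist x y < e})"
definition [code del]:
  "open (U :: quat set) \<longleftrightarrow> (\<forall>x\<in>U. eventually (\<lambda>(x', y). x' = x \<longrightarrow> y \<in> U) uniformity)"

instance
proof
  fix x y z :: quat and r :: real and U :: "quat set"
  show "dist x y = norm (x - y)" by (rule dist_quat_def)
  show "sgn x = x /\<^sub>R norm x" by (rule sgn_quat_def)
  show "uniformity = (INF e\<in>{0<..}. principal {(x :: quat, y). dist x y < e})"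
    by (rule uniformity_quat_def)
  show "open U \<longleftrightarrow> (\<forall>x\<in>U. eventually (\<lambda>(x', y). x' = x \<longrightarrow> y \<in> U) uniformity)"
    by (rule open_quat_def)
  show "inner x y = inner y x" "inner (x + y) z = inner x z + inner y z"
    "inner (scaleR r x) y = r * inner x y"
    by (simp_all add: inner_quat_def algebra_simps)
  show "0 \<le> inner x x" by (simp add: inner_quat_def)
  show "inner x x = 0 \<longleftrightarrow> x = 0"
    by (auto simp: inner_quat_def quat_eq_iff add_nonneg_eq_0_iff)
  show "norm x = sqrt (inner x x)"
    by (simp add: inner_quat_def norm_quat_def power2_eq_square)
qed

end

lemma norm_quat_power2: "(norm x)\<^sup>2 = (re x)\<^sup>2 + (im1 x)\<^sup>2 + (im2 x)\<^sup>2 + (im3 x)\<^sup>2"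
  by (simp add: norm_quat_def)

text \<open>The following justifies using \<^const>\<open>norm\<close> for the quaternionic modulus.\<close>

lemma qcnj_mult_self: "qcnj x * x = of_real ((norm x)\<^sup>2)" "x * qcnj x = of_real ((norm x)\<^sup>2)"
  unfolding norm_quat_power2 by (simp_all add: quat_eq_iff power2_eq_square del: of_real_power)

instantiation quat :: division_ring
begin

definition "inverse x = qcnj x /\<^sub>R (norm x)\<^sup>2"
definition "x div y = x * inverse y" for x y :: quat

instance
proof
  fix x y :: quat
  show "inverse x * x = 1" "x * inverse x = 1" if "x \<noteq> 0"
    using that
    by (simp_all add: inverse_quat_def qcnj_mult_self of_real_def del: of_real_power)
  show "x div y = x * inverse y" by (rule divide_quat_def)
  show "inverse (0 :: quat) = 0" by (simp add: inverse_quat_def)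
qed

end

instance quat :: real_normed_div_algebra
proof
  fix x y :: quat
  have "(norm (x * y))\<^sup>2 = (norm x * norm y)\<^sup>2"
    unfolding power_mult_distrib norm_quat_power2
    by (simp add: power2_eq_square algebra_simps)
  then show "norm (x * y) = norm x * norm y"
    by (metis mult_nonneg_nonneg norm_ge_zero power2_eq_imp_eq)
qed


section \<open>The group U(1,1;H) and its Moebius action\<close>

definition conj_transpose :: "quat^2^2 \<Rightarrow> quat^2^2" where
  "conj_transpose A = (\<chi> i j. qcnj (A $ j $ i))"

definition J11 :: "quat^2^2" where
  "J11 = vector [vector [1, 0], vector [0, - 1]]"

definition U11 :: "(quat^2^2) set" where
  "U11 = {A. invertible A \<and> conj_transpose A ** J11 ** A = J11}"

definition moebius_map :: "quat^2^2 \<Rightarrow> quat \<Rightarrow> quat" where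
  "moebius_map T z = (T $ 1 $ 1 * z + T $ 1 $ 2) * inverse (T $ 2 $ 1 * z + T $ 2 $ 2)"

definition triangle :: "quat^2^2 \<Rightarrow> real" where
  "triangle T = (norm (T $ 1 $ 2 - qcnj (T $ 2 $ 1)))\<^sup>2 - (re (T $ 1 $ 1) - re (T $ 2 $ 2))\<^sup>2"

text \<open>
  Ellipticity is a property of the transformation of the unit ball, expressed through a matrix
  inducing it.  Such a matrix is unique up to sign, and the three conditions do not change when
  the sign does, so the choice of matrix is immaterial.  Outside the unit ball the value of
  \<^const>\<open>moebius_map\<close> may be an artefact of \<open>inverse 0 = 0\<close>, so only the ball is compared.
\<close>

definition elliptic :: "(quat \<Rightarrow> quat) \<Rightarrow> bool" where
  "elliptic g \<longleftrightarrow> (\<exists>T\<in>U11. (\<forall>z\<in>ball 0 1. g z = moebius_map T z) \<and>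
    (let b = T $ 1 $ 2; c = T $ 2 $ 1; d = T $ 2 $ 2 in
      (b = 0 \<and> qcnj c = 0) \<or>
      (b = qcnj c \<and> qcnj c \<noteq> 0 \<and> (re d)\<^sup>2 < 1) \<or>
      (b \<noteq> qcnj c \<and> qcnj c \<noteq> 0 \<and> triangle T < 0)))"

definition diagonal :: "quat^2^2 \<Rightarrow> bool" where
  "diagonal A \<longleftrightarrow> (\<forall>i j. i \<noteq> j \<longrightarrow> A $ i $ j = 0)"

end

theory Submission
  imports Defs
begin

text \<open>
  Ellipticity forces an explicit fixed point \<open>z\<close> in the open unit ball.  Then \<open>(z, 1)\<close> is an
  eigenvector of \<open>T\<close>, and the hyperbolic translation moving \<open>z\<close> to \<open>0\<close> conjugates \<open>T\<close> to a
  matrix fixing \<open>0\<close>, which is diagonal.  Passing through the fixed point makes it unnecessary to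
  know that the matrix witnessing ellipticity agrees with \<open>T\<close> up to sign.
\<close>

section \<open>Quaternionic conjugation\<close>

lemma qcnj_qcnj [simp]: "qcnj (qcnj x) = x"
  by (simp add: quat_eq_iff)

lemma qcnj_add: "qcnj (x + y) = qcnj x + qcnj y"
  by (simp add: quat_eq_iff)

lemma qcnj_diff: "qcnj (x - y) = qcnj x - qcnj y"
  by (simp add: quat_eq_iff)

lemma qcnj_mult: "qcnj (x * y) = qcnj y * qcnj x"
  by (simp add: quat_eq_iff algebra_simps)

lemma norm_qcnj [simp]: "norm (qcnj x) = norm x"
  by (simp add: norm_quat_def)

lemma qcnj_add_self: "x + qcnj x = of_real (2 * re x)"
  by (simp add: quat_eq_iff del: of_real_mult)

lemma of_real_quat_mult_commute: "x * of_real r = of_real r * (x :: quat)"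
  by (simp add: quat_eq_iff)

section \<open>Inverses and entry relations in U(1,1;H)\<close>

lemma matrix_inv_eqI:
  fixes A B :: "'a::semiring_1^'n^'n"
  assumes "A ** B = mat 1" "B ** A = mat 1"
  shows "matrix_inv A = B"
proof -
  have "A ** matrix_inv A = mat 1 \<and> matrix_inv A ** A = mat 1"
    unfolding matrix_inv_def by (rule someI[of _ B]) (use assms in simp)
  then show ?thesis
    by (metis assms(2) matrix_mul_assoc matrix_mul_lid matrix_mul_rid)
qed

lemma J11_square: "J11 ** J11 = mat 1"
  by (simp add: J11_def vec_eq_iff forall_2 matrix_matrix_mult_def sum_2 mat_def)

text \<open>Multiplying the defining equation by \<open>J11\<close> gives a left inverse;
  invertibility makes it two-sided.\<close>

lemma U11_right_inverse:
  assumes "T \<in> U11"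
  shows "T ** (J11 ** conj_transpose T ** J11) = mat 1"
proof -
  obtain T' where T': "T ** T' = mat 1"
    using assms by (auto simp: U11_def invertible_def)
  have "(J11 ** conj_transpose T ** J11) ** T = mat 1"
    using assms J11_square by (simp add: U11_def flip: matrix_mul_assoc)
  then have "T' = J11 ** conj_transpose T ** J11"
    by (metis T' matrix_mul_assoc matrix_mul_lid matrix_mul_rid)
  with T' show ?thesis by simp
qed

text \<open>The defining equation relates the columns, the right inverse relates the rows;
  \<open>norm b = norm c\<close> comes from comparing the two expressions for
  \<open>(norm a)\<^sup>2 - 1\<close>.\<close>

lemma U11_entries:
  assumes T: "T \<in> U11"
  defines "a \<equiv> T $ 1 $ 1" and "b \<equiv> T $ 1 $ 2" and "c \<equiv> T $ 2 $ 1" and "d \<equiv> T $ 2 $ 2"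
  shows "qcnj a * a - qcnj c * c = 1" "qcnj d * d - qcnj b * b = 1"
    "qcnj a * b = qcnj c * d" "qcnj b * a = qcnj d * c"
    "a * qcnj c = b * qcnj d" "norm b = norm c" "(norm d)\<^sup>2 = 1 + (norm c)\<^sup>2"
proof -
  have "conj_transpose T ** J11 ** T = J11"
    using T by (simp add: U11_def)
  then have cols: "qcnj a * a - qcnj c * c = 1 \<and> qcnj b * b - qcnj d * d = - 1 \<and>
      qcnj a * b - qcnj c * d = 0 \<and> qcnj b * a - qcnj d * c = 0"
    by (simp add: a_def b_def c_def d_def J11_def conj_transpose_def vec_eq_iff forall_2
        matrix_matrix_mult_def sum_2 mat_def)
  have rows: "a * qcnj a - b * qcnj b = 1 \<and> b * qcnj d = a * qcnj c"
    using U11_right_inverse[OF T]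
    by (simp add: a_def b_def c_def d_def J11_def conj_transpose_def vec_eq_iff forall_2
        matrix_matrix_mult_def sum_2 mat_def algebra_simps)
  show "qcnj a * a - qcnj c * c = 1" "qcnj a * b = qcnj c * d" "qcnj b * a = qcnj d * c"
    "a * qcnj c = b * qcnj d"
    using cols rows by auto
  show d: "qcnj d * d - qcnj b * b = 1"
    using cols by (metis minus_diff_eq minus_minus)
  have "(norm a)\<^sup>2 - (norm c)\<^sup>2 = 1" "(norm a)\<^sup>2 - (norm b)\<^sup>2 = 1" "(norm d)\<^sup>2 - (norm b)\<^sup>2 = 1"
    using cols rows d unfolding qcnj_mult_self of_real_diff[symmetric] of_real_eq_1_iff by auto
  then have "(norm d)\<^sup>2 = 1 + (norm c)\<^sup>2" and "(norm b)\<^sup>2 = (norm c)\<^sup>2"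
    by linarith+
  then show "(norm d)\<^sup>2 = 1 + (norm c)\<^sup>2" and "norm b = norm c"
    by (simp_all add: power2_eq_iff_nonneg)
qed

text \<open>In the ball \<open>c * z\<close> is no longer than \<open>c\<close>, hence too short to
  cancel \<open>d\<close>.\<close>

lemma U11_denominator_nonzero:
  assumes "T \<in> U11" "norm z < 1"
  shows "T $ 2 $ 1 * z + T $ 2 $ 2 \<noteq> 0"
proof
  assume "T $ 2 $ 1 * z + T $ 2 $ 2 = 0"
  then have "norm (T $ 2 $ 2) = norm (T $ 2 $ 1) * norm z"
    by (metis add_eq_0_iff norm_minus_cancel norm_mult)
  also have "\<dots> \<le> norm (T $ 2 $ 1)"
    using assms(2) by (simp add: mult_left_le)
  finally have "(norm (T $ 2 $ 2))\<^sup>2 \<le> (norm (T $ 2 $ 1))\<^sup>2"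
    by (simp add: power_mono)
  with U11_entries(7)[OF assms(1)] show False by simp
qed

section \<open>Fixed points in the unit ball\<close>

lemma moebius_map_fixed_iff:
  assumes "T \<in> U11" "norm z < 1"
  shows "moebius_map T z = z \<longleftrightarrow>
    T $ 1 $ 1 * z + T $ 1 $ 2 = z * (T $ 2 $ 1 * z + T $ 2 $ 2)"
  using U11_denominator_nonzero[OF assms]
  by (metis (no_types, lifting) moebius_map_def divide_inverse nonzero_divide_eq_eq)

text \<open>
  The fixed point is the ratio of the entries of an eigenvector of \<open>T + T\<^sup>-\<^sup>1\<close>, a matrix with rows
  \<open>2 a\<^sub>0, e\<close> and \<open>- qcnj e, 2 d\<^sub>0\<close>: it commutes with \<open>T\<close>, and its eigenvalues \<open>2 a\<^sub>0 + r\<close> are real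
  and distinct.
\<close>

lemma fixed_point_if_triangle_neg:
  assumes T: "T \<in> U11" and neg: "triangle T < 0"
  shows "\<exists>z. norm z < 1 \<and> moebius_map T z = z"
proof -
  define a b c d where "a = T $ 1 $ 1" and "b = T $ 1 $ 2" and "c = T $ 2 $ 1" and "d = T $ 2 $ 2"
  note defs = a_def b_def c_def d_def
  note ent = U11_entries[OF T, folded defs]
  define e where "e = b - qcnj c"
  define m where "m = re d - re a"
  have lt: "(norm e)\<^sup>2 < m\<^sup>2"
    using neg by (simp add: triangle_def e_def m_def defs power2_commute)
  \<comment> \<open>The root of \<open>r\<^sup>2 - 2 * m * r + (norm e)\<^sup>2 = 0\<close> of
    larger modulus: the sign lets the square root add to \<open>m\<close>, so
    \<open>norm e < \<bar>m\<bar> \<le> \<bar>r\<bar>\<close> and \<open>e / r\<close> lies in the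
    ball.\<close>
  define r where "r = m + (if m \<ge> 0 then 1 else - 1) * sqrt (m\<^sup>2 - (norm e)\<^sup>2)"
  have r_quad: "r\<^sup>2 = 2 * m * r - (norm e)\<^sup>2"
  proof -
    have "(r - m)\<^sup>2 = m\<^sup>2 - (norm e)\<^sup>2"
      using lt by (simp add: r_def power_mult_distrib)
    then show ?thesis by (simp add: power2_eq_square algebra_simps)
  qed
  have "norm e < \<bar>m\<bar>"
    using lt by (simp add: power2_less_imp_less)
  also have "\<bar>m\<bar> \<le> \<bar>r\<bar>"
  proof -
    have "sqrt (m\<^sup>2 - (norm e)\<^sup>2) \<ge> 0"
      using lt by (intro real_sqrt_ge_zero) simp
    then show ?thesis by (auto simp: r_def simp del: real_sqrt_ge_0_iff)
  qed
  finally have er: "norm e < \<bar>r\<bar>" .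
  then have r0: "r \<noteq> 0" by auto
  define z where "z = e /\<^sub>R r"
  have "norm z < 1"
    using er r0 by (simp add: z_def divide_simps)
  have lin: "a * e + (2 * m) *\<^sub>R b = e * d"
  proof -
    have "(2 * m) *\<^sub>R b = of_real (2 * re d) * b - of_real (2 * re a) * b"
      by (simp add: m_def of_real_def algebra_simps del: of_real_mult)
    also have "\<dots> = b * (d + qcnj d) - (a + qcnj a) * b"
      unfolding qcnj_add_self of_real_quat_mult_commute ..
    finally show ?thesis
      using ent(3,5) by (simp add: e_def algebra_simps)
  qed
  have "e * c = - b * qcnj e"
    using ent(6) qcnj_mult_self
    by (simp add: e_def qcnj_diff algebra_simps)
  then have "e * c * e = - b * (qcnj e * e)"
    by (simp add: mult.assoc)
  also have "\<dots> = - ((norm e)\<^sup>2 *\<^sub>R b)"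
    unfolding qcnj_mult_self of_real_def by simp
  finally have quad: "e * c * e = - ((norm e)\<^sup>2 *\<^sub>R b)" .
  have r1: "r * (r * (inverse r * inverse r)) = 1"
    using r0 by (simp add: field_simps)
  \<comment> \<open>Scaling by \<open>r\<^sup>2\<close> clears denominators; \<open>r_quad\<close>
    then splits the \<open>b\<close> term into the parts that \<open>lin\<close> and
    \<open>quad\<close> absorb.\<close>
  have "r\<^sup>2 *\<^sub>R (a * z + b) = r *\<^sub>R (a * e) + r\<^sup>2 *\<^sub>R b"
    using r0 by (simp add: z_def scaleR_add_right power2_eq_square)
  also have "\<dots> = r *\<^sub>R (a * e + (2 * m) *\<^sub>R b) - (norm e)\<^sup>2 *\<^sub>R b"
    unfolding r_quad by (simp add: algebra_simps)
  also have "\<dots> = r\<^sup>2 *\<^sub>R (z * (c * z + d))"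
    unfolding lin using quad r0 r1 by (simp add: z_def algebra_simps power2_eq_square)
  finally have "a * z + b = z * (c * z + d)"
    using r0 by simp
  then show ?thesis
    using moebius_map_fixed_iff[OF T \<open>norm z < 1\<close>] \<open>norm z < 1\<close> by (auto simp: defs)
qed

text \<open>
  With \<open>z = b w\<close> and \<open>w\<close> commuting with \<open>d\<close>, the fixed point equation becomes the quadratic equation
  \<open>|b|\<^sup>2 w\<^sup>2 + 2 u w = 1\<close>, where \<open>u\<close> is the imaginary part of \<open>d\<close>; its solutions are \<open>w = k u\<close>.
\<close>

lemma fixed_point_if_hermitian_off_diagonal:
  assumes T: "T \<in> U11" and herm: "T $ 1 $ 2 = qcnj (T $ 2 $ 1)"
    and b0: "T $ 1 $ 2 \<noteq> 0" and d1: "(re (T $ 2 $ 2))\<^sup>2 < 1"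
  shows "\<exists>z. norm z < 1 \<and> moebius_map T z = z"
proof -
  define a b c d where "a = T $ 1 $ 1" and "b = T $ 1 $ 2" and "c = T $ 2 $ 1" and "d = T $ 2 $ 2"
  note defs = a_def b_def c_def d_def
  note ent = U11_entries[OF T, folded defs]
  have c: "c = qcnj b"
    using herm by (simp add: defs)
  define u where "u = d - of_real (re d)"
  define n where "n = norm u"
  define s where "s = sqrt (1 - (re d)\<^sup>2)"
  define B where "B = (norm b)\<^sup>2"
  \<comment> \<open>Of the two real roots of \<open>k_quad\<close>, the one of smaller modulus; the
    other gives the fixed point outside the ball.\<close>
  define k where "k = (s - n) / (n * B)"
  have s2: "s\<^sup>2 = 1 - (re d)\<^sup>2" and s0: "s > 0"
    using d1 by (simp_all add: s_def defs)
  have B0: "B > 0"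
    using b0 by (simp add: B_def defs)
  have "n\<^sup>2 = (norm d)\<^sup>2 - (re d)\<^sup>2"
    by (simp add: n_def u_def norm_quat_power2)
  then have n2: "n\<^sup>2 = s\<^sup>2 + B"
    using ent(6,7) s2 by (simp add: B_def)
  have "n \<ge> 0" by (simp add: n_def)
  have "s < n"
    by (rule power2_less_imp_less) (use n2 B0 \<open>n \<ge> 0\<close> in auto)
  then have n0: "n > 0" using s0 by simp
  have kB: "k * n * B = s - n"
    using n0 B0 by (simp add: k_def)
  have "(n\<^sup>2 * (B * k\<^sup>2 + 2 * k) + 1) * B = (k * n * B)\<^sup>2 + 2 * n * (k * n * B) + B"
    by (simp add: power2_eq_square algebra_simps)
  also have "\<dots> = s\<^sup>2 - n\<^sup>2 + B"
    unfolding kB by (simp add: power2_eq_square algebra_simps)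
  finally have k_quad: "n\<^sup>2 * (B * k\<^sup>2 + 2 * k) + 1 = 0"
    using n2 B0 by simp
  define z where "z = k *\<^sub>R (b * u)"
  have "norm z * norm b = \<bar>k * n * B\<bar>"
    using \<open>n \<ge> 0\<close> B0 by (simp add: z_def norm_mult n_def[symmetric] B_def abs_mult power2_eq_square)
  also have "\<dots> = n - s"
    unfolding kB using \<open>s < n\<close> by simp
  \<comment> \<open>The triangle inequality for a right triangle with legs \<open>s\<close>,
    \<open>norm b\<close> and hypotenuse \<open>n\<close>.\<close>
  also have "n - s < norm b"
  proof -
    have "n\<^sup>2 < (s + norm b)\<^sup>2"
      using n2 s0 b0 by (simp add: B_def power2_sum defs)
    then show ?thesis
      using s0 by (smt (verit) norm_ge_zero power2_less_imp_less)
  qed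
  finally have "norm z < 1"
    using b0 by (simp add: defs)
  have u2: "u * u = - (of_real (n\<^sup>2))"
    unfolding n_def norm_quat_power2
    by (simp add: u_def quat_eq_iff power2_eq_square del: of_real_power)
  \<comment> \<open>\<open>d\<close> commutes with its imaginary part \<open>u\<close>, and
    \<open>qcnj d - d = - 2 u\<close>.\<close>
  have d: "qcnj d * u - u * d = - (2 *\<^sub>R (u * u))"
    by (simp add: u_def quat_eq_iff algebra_simps)
  have ab: "a * b = b * qcnj d"
    using ent(5) by (simp add: c)
  have "z * c * z = k\<^sup>2 *\<^sub>R (b * u * (qcnj b * b) * u)"
    by (simp add: z_def c power2_eq_square mult.assoc)
  also have "\<dots> = (k\<^sup>2 * B) *\<^sub>R (b * (u * u))"
    unfolding qcnj_mult_self B_def[symmetric] of_real_def by (simp add: mult.assoc)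
  finally have zcz: "z * c * z = (k\<^sup>2 * B) *\<^sub>R (b * (u * u))" .
  have "a * z - z * d = k *\<^sub>R (b * (qcnj d * u - u * d))"
    using ab by (simp add: z_def algebra_simps flip: mult.assoc)
  also have "\<dots> = - ((2 * k) *\<^sub>R (b * (u * u)))"
    unfolding d by simp
  finally have azzd: "a * z - z * d = - ((2 * k) *\<^sub>R (b * (u * u)))" .
  have "a * z + b - z * (c * z + d) = (a * z - z * d) + b - z * c * z"
    by (simp add: algebra_simps)
  also have "\<dots> = (n\<^sup>2 * (B * k\<^sup>2 + 2 * k) + 1) *\<^sub>R b"
    unfolding azzd zcz u2 of_real_def by (simp add: algebra_simps)
  finally have "a * z + b = z * (c * z + d)"
    unfolding k_quad by simp
  then show ?thesis
    using moebius_map_fixed_iff[OF T \<open>norm z < 1\<close>] \<open>norm z < 1\<close> by (auto simp: defs)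
qed

text \<open>The fixed point of the witnessing matrix lies in the ball, where that matrix induces
  \<open>g\<close>.\<close>

lemma elliptic_imp_fixed_point:
  assumes "elliptic g"
  shows "\<exists>z. norm z < 1 \<and> g z = z"
proof -
  obtain S where S: "S \<in> U11" and g: "\<And>z. norm z < 1 \<Longrightarrow> g z = moebius_map S z"
    and cases: "S $ 1 $ 2 = 0 \<or> S $ 1 $ 2 = qcnj (S $ 2 $ 1) \<and> S $ 1 $ 2 \<noteq> 0 \<and> (re (S $ 2 $ 2))\<^sup>2 < 1 \<or>
      triangle S < 0"
    using assms unfolding elliptic_def Let_def by (metis dist_0_norm mem_ball)
  have "\<exists>z. norm z < 1 \<and> moebius_map S z = z"
    using cases
  proof (elim disjE conjE)
    assume "S $ 1 $ 2 = 0"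
    then show ?thesis
      by (intro exI[of _ 0]) (simp add: moebius_map_def)
  qed (use S fixed_point_if_hermitian_off_diagonal fixed_point_if_triangle_neg in blast)+
  with g show ?thesis by metis
qed

section \<open>Moving the fixed point to the centre\<close>

lemma diagonalizable_if_fixed_point:
  assumes T: "T \<in> U11" and z: "norm z < 1" and fixed: "moebius_map T z = z"
  shows "\<exists>X\<in>U11. diagonal (X ** T ** matrix_inv X)"
proof -
  define a b c d where "a = T $ 1 $ 1" and "b = T $ 1 $ 2" and "c = T $ 2 $ 1" and "d = T $ 2 $ 2"
  note defs = a_def b_def c_def d_def
  note ent = U11_entries[OF T, folded defs]
  define l where "l = c * z + d"
  have fix_eq: "a * z + b = z * l"
    using fixed moebius_map_fixed_iff[OF T z] by (simp add: defs l_def)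
  have l0: "l \<noteq> 0"
    using U11_denominator_nonzero[OF T z] by (simp add: defs l_def)
  \<comment> \<open>The row \<open>(qcnj z, - 1)\<close> is a left eigenvector of \<open>T\<close>, with eigenvalue \<open>inverse (qcnj l)\<close>.\<close>
  have dual: "qcnj z * a - c = (d - qcnj z * b) * qcnj z"
  proof -
    have zl: "qcnj l * qcnj z = qcnj z * qcnj a + qcnj b"
      by (simp add: qcnj_mult[symmetric] qcnj_add[symmetric] flip: fix_eq)
    have l: "qcnj l = qcnj z * qcnj c + qcnj d"
      by (simp add: l_def qcnj_mult qcnj_add)
    \<comment> \<open>Both sides of \<open>dual\<close>, multiplied by \<open>qcnj l\<close> on the
      left, reduce to \<open>qcnj z\<close> by the column relations.\<close>
    have "qcnj l * (qcnj z * a - c) = (qcnj l * qcnj z) * a - qcnj l * c"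
      by (simp add: algebra_simps)
    also have "\<dots> = qcnj z * (qcnj a * a - qcnj c * c) + (qcnj b * a - qcnj d * c)"
      unfolding zl unfolding l by (simp add: algebra_simps)
    finally have 1: "qcnj l * (qcnj z * a - c) = qcnj z"
      using ent(1,4) by simp
    have "qcnj l * (d - qcnj z * b) = qcnj l * d - (qcnj l * qcnj z) * b"
      by (simp add: algebra_simps)
    also have "\<dots> = qcnj z * (qcnj c * d - qcnj a * b) + (qcnj d * d - qcnj b * b)"
      unfolding zl unfolding l by (simp add: algebra_simps)
    finally have 2: "qcnj l * (d - qcnj z * b) = 1"
      using ent(2,3) by simp
    have "qcnj l * (qcnj z * a - c) = qcnj l * ((d - qcnj z * b) * qcnj z)"
      using 1 2 by (simp flip: mult.assoc)
    moreover have "qcnj l \<noteq> 0"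
      using l0 by (metis norm_eq_zero norm_qcnj)
    ultimately show ?thesis by simp
  qed
  define s where "s = 1 / sqrt (1 - (norm z)\<^sup>2)"
  have "(norm z)\<^sup>2 < 1"
    using z by (simp add: power_less_one_iff)
  then have "s * s * (1 - (norm z)\<^sup>2) = 1"
    by (simp add: s_def)
  then have s: "s * s - s * s * (norm z)\<^sup>2 = 1"
    unfolding right_diff_distrib by simp
  have s1: "s *\<^sub>R s *\<^sub>R 1 - s *\<^sub>R s *\<^sub>R of_real ((norm z)\<^sup>2) = (1 :: quat)"
    using s by (simp add: quat_eq_iff mult.assoc del: of_real_power)
  then have s2: "s *\<^sub>R s *\<^sub>R of_real ((norm z)\<^sup>2) - s *\<^sub>R s *\<^sub>R 1 = (- 1 :: quat)"
    by (metis minus_diff_eq)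
  \<comment> \<open>\<open>X\<close> induces the translation taking w to
    \<open>(w - z) * inverse (1 - qcnj z * w)\<close>, with \<open>s\<close> normalising it to
    preserve \<open>J11\<close>; \<open>Y\<close> is \<open>X\<close> with \<open>- z\<close> for
    \<open>z\<close>.\<close>
  define X :: "quat^2^2" where "X = vector [vector [s *\<^sub>R 1, - (s *\<^sub>R z)], vector [- (s *\<^sub>R qcnj z), s *\<^sub>R 1]]"
  define Y :: "quat^2^2" where "Y = vector [vector [s *\<^sub>R 1, s *\<^sub>R z], vector [s *\<^sub>R qcnj z, s *\<^sub>R 1]]"
  have XY: "X ** Y = mat 1" and YX: "Y ** X = mat 1"
    using s1 by (simp_all add: X_def Y_def vec_eq_iff forall_2 matrix_matrix_mult_def sum_2 mat_def
        qcnj_mult_self del: of_real_power)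
  have cnj_scale: "qcnj (s *\<^sub>R q) = s *\<^sub>R qcnj q" "qcnj (- q) = - qcnj q" "qcnj 1 = 1" for q
    by (simp_all add: quat_eq_iff)
  have "conj_transpose X ** J11 ** X = J11"
    using s1 s2
    by (simp add: X_def J11_def conj_transpose_def vec_eq_iff forall_2
        matrix_matrix_mult_def sum_2 cnj_scale qcnj_mult_self del: of_real_power)
  moreover have "invertible X"
    using XY YX by (auto simp: invertible_def)
  ultimately have "X \<in> U11"
    by (simp add: U11_def)
  moreover have "diagonal (X ** T ** matrix_inv X)"
  proof -
    \<comment> \<open>The off-diagonal entries are the defects of the right and left eigenvector
      equations, up to scaling.\<close>
    have "(X ** T ** Y) $ 1 $ 2 = (s * s) *\<^sub>R (a * z + b - z * l)"
      by (simp add: X_def Y_def matrix_matrix_mult_def sum_2 l_def algebra_simps flip: defs)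
    moreover have "(X ** T ** Y) $ 2 $ 1 = (s * s) *\<^sub>R ((d - qcnj z * b) * qcnj z - (qcnj z * a - c))"
      by (simp add: X_def Y_def matrix_matrix_mult_def sum_2 algebra_simps flip: defs)
    ultimately show ?thesis
      unfolding matrix_inv_eqI[OF XY YX] diagonal_def forall_2 using fix_eq dual by simp
  qed
  ultimately show ?thesis by blast
qed

theorem theorem3p1:
  fixes T :: "quat^2^2"
  assumes "T \<in> U11"
    and "elliptic (moebius_map T)"
  shows "\<exists>X\<in>U11. diagonal (X ** T ** matrix_inv X)"
  using elliptic_imp_fixed_point[OF assms(2)] diagonalizable_if_fixed_point[OF assms(1)] by blast

end
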